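(* For the Hanoi Towers group $H^{(3)}$, the set $\kappa$ of singular points is a countable set, equal to the disjoint union of the orbits (under $H^{(3)}$) of the three points $0^\omega$, $1^\omega$ and $2^\omega$. Moreover, for each $i\in\{0,1,2\}$, $F(i^\omega)=\mathrm{Sch}(i^\omega)$ is an isolated point in the closure of $F(\{0,1,2\}^\omega)$.
   Context: $H^{(3)}$ is the group of automorphisms of the rooted ternary tree $\{0,1,2\}^*$ generated by $a,b,c$ defined recursively, for $w\in\{0,1,2\}^*$, by: $a\circ(0w)=1w$, $a\circ(1w)=0w$, $a\circ(2w)=2(a\circ w)$; $b\circ(0w)=2w$, $b\circ(2w)=0w$, $b\circ(1w)=1(b\circ w)$; $c\circ(1w)=2w$, $c\circ(2w)=1w$, $c\circ(0w)=0(c\circ w)$. It acts on the boundary $\{0,1,2\}^\omega$ (product topology). A point $\xi$ of the boundary is singular if the map $\xi\mapsto\mathrm{Stab}(\xi)=\{g:g\circ\xi=\xi\}$ from the boundary to the space of subgroups of $H^{(3)}$ (topology induced from $\{0,1\}^{H^{(3)}}$) is not continuous at $\xi$; $\kappa$ is the set of singular points. $\mathrm{Sch}(\xi)$ is the Schreier graph of $\xi$, marked at $\xi$: its vertices are the elements of the orbit of $\xi$, its edges are $\eta\xrightarrow{s}s\circ\eta$ for $s$ in the set of generators (the states $a,b,c,1$ of the generating automaton and their formal inverses, $1$ denoting the sink-state, acting as the identity), and $\xi$ is its marked vertex. $F$ is the map $\xi\mapsto\mathrm{Sch}(\xi)$ into the space of (isomorphism classes of) marked labeled graphs, with the topology in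 which two marked graphs are close when the balls of a large radius around their marked vertices are isomorphic as marked labeled graphs. The closure is taken in this space. *)

theory Defs
  imports "HOL-Analysis.Analysis" "HOL-Algebra.Bij" "HOL-Algebra.Group_Action"
    "HOL-Algebra.Elementary_Groups"
begin

section \<open>The Hanoi Towers group\<close>

datatype digit = D0 | D1 | D2

type_synonym vertex = "digit list"

definition child_of :: "vertex \<Rightarrow> vertex \<Rightarrow> bool" where
  "child_of v w \<longleftrightarrow> (\<exists>x. v = w @ [x])"

definition tree_auts :: "(vertex \<Rightarrow> vertex) set" where
  "tree_auts = {f. bij f \<and> f [] = [] \<and> (\<forall>v w. child_of v w \<longrightarrow> child_of (f v) (f w))}"

definition tree_aut_group :: "(vertex \<Rightarrow> vertex) monoid" where
  "tree_aut_group = (BijGroup UNIV)\<lparr>carrier := tree_auts\<rparr>"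

fun hanoi_a :: "vertex \<Rightarrow> vertex" where
  "hanoi_a [] = []"
| "hanoi_a (D0 # w) = D1 # w"
| "hanoi_a (D1 # w) = D0 # w"
| "hanoi_a (D2 # w) = D2 # hanoi_a w"

fun hanoi_b :: "vertex \<Rightarrow> vertex" where
  "hanoi_b [] = []"
| "hanoi_b (D0 # w) = D2 # w"
| "hanoi_b (D2 # w) = D0 # w"
| "hanoi_b (D1 # w) = D1 # hanoi_b w"

fun hanoi_c :: "vertex \<Rightarrow> vertex" where
  "hanoi_c [] = []"
| "hanoi_c (D1 # w) = D2 # w"
| "hanoi_c (D2 # w) = D1 # w"
| "hanoi_c (D0 # w) = D0 # hanoi_c w"

text \<open>The library's \<open>subgroup_generated G S\<close> silently drops the elements of \<open>S\<close> outside the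
  carrier of \<open>G\<close>; the lemma \<open>hanoi_generators_in_carrier\<close> below shows that none is dropped here.\<close>

definition hanoi_group :: "(vertex \<Rightarrow> vertex) monoid" where
  "hanoi_group = subgroup_generated tree_aut_group {hanoi_a, hanoi_b, hanoi_c}"

lemma tree_aut_group_is_group: "group tree_aut_group"
proof -
  have inverse: "inv_into UNIV f \<in> tree_auts" if f: "f \<in> tree_auts" for f
  proof -
    let ?g = "inv_into UNIV f"
    have bf: "bij f" and f0: "f [] = []"
      and fc: "\<And>v w. child_of v w \<Longrightarrow> child_of (f v) (f w)"
      using f by (auto simp: tree_auts_def)
    have gf: "?g (f v) = v" and fg: "f (?g v) = v" for v
      using bf by (simp_all add: bij_is_inj bij_is_surj surj_f_inv_f)
    have "child_of (?g v) (?g w)" if "child_of v w" for v w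
    proof -
      have "?g v \<noteq> []"
        using fg[of v] f0 that by (auto simp: child_of_def)
      then obtain u x where u: "?g v = u @ [x]"
        by (meson rev_exhaust)
      then have "child_of (f (?g v)) (f u)"
        by (intro fc) (simp add: child_of_def)
      then have "f u = w"
        using that by (auto simp: fg child_of_def)
      then show ?thesis
        using u gf[of u] by (auto simp: child_of_def)
    qed
    moreover have "bij ?g" using bf by (rule bij_imp_bij_inv)
    moreover have "?g [] = []" using gf[of "[]"] f0 by simp
    ultimately show ?thesis by (simp add: tree_auts_def)
  qed
  have "subgroup tree_auts (BijGroup UNIV)"
  proof (rule group.subgroupI[OF group_BijGroup])
    show "tree_auts \<subseteq> carrier (BijGroup UNIV)"
      by (auto simp: tree_auts_def BijGroup_def Bij_def)
    show "tree_auts \<noteq> {}"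
      using bij_id by (auto simp: tree_auts_def intro!: exI[of _ id])
    show "inv\<^bsub>BijGroup UNIV\<^esub> f \<in> tree_auts" if "f \<in> tree_auts" for f
      using inverse[OF that] that by (subst inv_BijGroup) (auto simp: tree_auts_def Bij_def)
    show "f \<otimes>\<^bsub>BijGroup UNIV\<^esub> g \<in> tree_auts" if "f \<in> tree_auts" "g \<in> tree_auts" for f g
      using that bij_comp[of g f]
      by (auto simp: tree_auts_def BijGroup_def Bij_def compose_def comp_def)
  qed
  then show ?thesis
    unfolding tree_aut_group_def by (rule group.subgroup_imp_group[OF group_BijGroup])
qed

lemma hanoi_generators_in_carrier:
  "{hanoi_a, hanoi_b, hanoi_c} \<subseteq> carrier tree_aut_group"
proof -
  have "hanoi_a (hanoi_a w) = w" for w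
    by (induction w rule: hanoi_a.induct) simp_all
  moreover have "hanoi_b (hanoi_b w) = w" for w
    by (induction w rule: hanoi_b.induct) simp_all
  moreover have "hanoi_c (hanoi_c w) = w" for w
    by (induction w rule: hanoi_c.induct) simp_all
  ultimately have "bij hanoi_a" "bij hanoi_b" "bij hanoi_c"
    by (metis involuntory_imp_bij)+
  moreover have "\<exists>y. hanoi_a (w @ [x]) = hanoi_a w @ [y]" for w x
    by (induction w rule: hanoi_a.induct; cases x; simp)
  moreover have "\<exists>y. hanoi_b (w @ [x]) = hanoi_b w @ [y]" for w x
    by (induction w rule: hanoi_b.induct; cases x; simp)
  moreover have "\<exists>y. hanoi_c (w @ [x]) = hanoi_c w @ [y]" for w x
    by (induction w rule: hanoi_c.induct; cases x; simp)
  ultimately show ?thesis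
    by (auto simp: tree_aut_group_def tree_auts_def child_of_def)
qed

section \<open>Action on the boundary and singular points\<close>

type_synonym boundary = "nat \<Rightarrow> digit"

definition boundary_topology :: "boundary topology" where
  "boundary_topology = product_topology (\<lambda>_. discrete_topology UNIV) UNIV"

text \<open>The image of \<open>\<xi>\<close> is the ray whose finite prefixes are the images of the prefixes of \<open>\<xi>\<close>;
  its digit number \<open>n\<close> is thus the last digit of the image of the prefix of length \<open>n + 1\<close>.\<close>

definition boundary_act :: "(vertex \<Rightarrow> vertex) \<Rightarrow> boundary \<Rightarrow> boundary" where
  "boundary_act g \<xi> = (\<lambda>n. g (map \<xi> [0..<Suc n]) ! n)"

abbreviation hanoi_orbit :: "boundary \<Rightarrow> boundary set" where
  "hanoi_orbit \<equiv> orbit hanoi_group boundary_act"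

text \<open>Subgroups of \<open>G\<close> are compared through their indicator functions in \<open>bool\<close>-valued functions
  on the carrier of \<open>G\<close>, with the product topology.\<close>

definition subgroup_topology :: "('a, 'm) monoid_scheme \<Rightarrow> 'a set topology" where
  "subgroup_topology G =
     pullback_topology {K. subgroup K G} (\<lambda>K. \<lambda>g\<in>carrier G. g \<in> K)
       (product_topology (\<lambda>_. discrete_topology (UNIV :: bool set)) (carrier G))"

definition singular_points :: "boundary set" where
  "singular_points =
     {\<xi>. \<not> topcontinuous_at boundary_topology (subgroup_topology hanoi_group)
            (stabilizer hanoi_group boundary_act) \<xi>}"

section \<open>The space of marked labeled graphs\<close>

record ('v, 'l) marked_graph =
  verts :: "'v set"
  edges :: "('v \<times> 'l \<times> 'v) set"
  mark :: 'v

definition adjacent :: "('v, 'l) marked_graph \<Rightarrow> ('v \<times> 'v) set" where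
  "adjacent G = {(u, v). \<exists>l. (u, l, v) \<in> edges G \<or> (v, l, u) \<in> edges G}"

definition ball_verts :: "('v, 'l) marked_graph \<Rightarrow> nat \<Rightarrow> 'v set" where
  "ball_verts G r = {v. \<exists>k\<le>r. (mark G, v) \<in> adjacent G ^^ k}"

definition graph_ball :: "('v, 'l) marked_graph \<Rightarrow> nat \<Rightarrow> ('v, 'l) marked_graph" where
  "graph_ball G r =
     \<lparr>verts = ball_verts G r,
      edges = {(u, l, v) \<in> edges G. u \<in> ball_verts G r \<and> v \<in> ball_verts G r},
      mark = mark G\<rparr>"

text \<open>Graphs are required to be connected: the balls around the marked vertex only see its
  connected component.\<close>

definition is_marked_graph :: "('v, 'l) marked_graph \<Rightarrow> bool" where
  "is_marked_graph G \<longleftrightarrow>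
     mark G \<in> verts G \<and> edges G \<subseteq> verts G \<times> UNIV \<times> verts G \<and>
     (\<forall>v\<in>verts G. (mark G, v) \<in> (adjacent G)\<^sup>*)"

definition graph_isomorphic ::
    "('v, 'l) marked_graph \<Rightarrow> ('w, 'l) marked_graph \<Rightarrow> bool" where
  "graph_isomorphic G G' \<longleftrightarrow>
     (\<exists>f. bij_betw f (verts G) (verts G') \<and> f (mark G) = mark G' \<and>
        (\<forall>u\<in>verts G. \<forall>v\<in>verts G. \<forall>l. (u, l, v) \<in> edges G \<longleftrightarrow> (f u, l, f v) \<in> edges G'))"

definition iso_class :: "('v, 'l) marked_graph \<Rightarrow> ('v, 'l) marked_graph set" where
  "iso_class G = {G'. is_marked_graph G' \<and> graph_isomorphic G G'}"

definition graph_space :: "('v, 'l) marked_graph set topology" where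
  "graph_space = topology_generated_by
     {{iso_class G' |G'. is_marked_graph G' \<and> graph_isomorphic (graph_ball G r) (graph_ball G' r)}
        |(G :: ('v, 'l) marked_graph) r. is_marked_graph G}"

section \<open>Schreier graphs\<close>

datatype state = Sa | Sb | Sc | Sink

datatype label = Gen state | Inv state

fun state_map :: "state \<Rightarrow> vertex \<Rightarrow> vertex" where
  "state_map Sa = hanoi_a"
| "state_map Sb = hanoi_b"
| "state_map Sc = hanoi_c"
| "state_map Sink = (\<lambda>w. w)"

fun label_map :: "label \<Rightarrow> vertex \<Rightarrow> vertex" where
  "label_map (Gen s) = state_map s"
| "label_map (Inv s) = inv\<^bsub>hanoi_group\<^esub> (state_map s)"

definition schreier_graph :: "boundary \<Rightarrow> (boundary, label) marked_graph" where
  "schreier_graph \<xi> =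
     \<lparr>verts = hanoi_orbit \<xi>,
      edges = {(\<eta>, s, boundary_act (label_map s) \<eta>) |\<eta> s. \<eta> \<in> hanoi_orbit \<xi>},
      mark = \<xi>\<rparr>"

text \<open>Points of the graph space are isomorphism classes of graphs with vertices in the uncountable
  type \<open>boundary\<close>. A connected graph all of whose balls are isomorphic to balls of Schreier graphs
  is locally finite, hence countable, so this choice of ambient type loses no point of the closure
  of the image of the boundary.\<close>

definition sch_map :: "boundary \<Rightarrow> (boundary, label) marked_graph set" where
  "sch_map \<xi> = iso_class (schreier_graph \<xi>)"

end

theory Submission
  imports Defs
begin

text \<open>Each generator leaves one digit \<open>d\<close> alone and exchanges the other two at the first place
  where one of them occurs (in the Towers of Hanoi, a move between the two pegs other than
  \<open>d\<close>). Hence it changes at most one digit of a ray, its only fixed ray is \<open>d\<^sup>\<omega>\<close>, and at every other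
  ray it acts, on a whole neighbourhood, by rewriting a finite prefix and keeping the rest.
  Everything follows from these facts.

  \<^item> The map \<open>\<xi> \<mapsto> Stab(\<xi>)\<close> is continuous at \<open>\<xi>\<close> iff each \<open>g\<close> is either in \<open>Stab(\<eta>)\<close> for all \<open>\<eta>\<close> near
    \<open>\<xi>\<close> or for none of them (\<open>topcontinuous_at_subgroup_iff\<close>). Outside the orbits of the three
    constant rays, writing \<open>g\<close> as a word, no letter ever meets its fixed ray, so \<open>g\<close> itself is
    locally a rewriting of a prefix (\<open>acts_on_prefix_off_constant_orbits\<close>). If it fixes \<open>\<xi>\<close>, then it
    rewrites the prefix of \<open>\<xi>\<close> to itself and fixes a neighbourhood: \<open>\<xi>\<close> is regular. On the orbit of
    \<open>d\<^sup>\<omega>\<close>, a conjugate of the generator that avoids \<open>d\<close> has a single fixed ray, which makes that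
    ray singular (\<open>constant_orbits_singular\<close>).

  \<^item> The group is countable, hence so are the orbits. A ray in the orbit of \<open>i\<^sup>\<omega>\<close> differs from
    \<open>i\<^sup>\<omega>\<close> in finitely many digits, so the three orbits are disjoint.

  \<^item> A loop at the marked vertex of \<open>Sch(\<xi>)\<close>, labeled by the generator that avoids \<open>i\<close>, exists iff
    \<open>\<xi> = i\<^sup>\<omega>\<close>. The presence of that loop is visible in the ball of radius \<open>0\<close>. If a graph in the
    closure has the loop, then so do the Schreier graphs that approximate it, which are therefore all
    equal to \<open>Sch(i\<^sup>\<omega>)\<close>. Thus all balls of the graph are isomorphic to those of \<open>Sch(i\<^sup>\<omega>)\<close>, and
    then so is the graph (\<open>graph_isomorphic_if_balls_isomorphic\<close>).\<close>

section \<open>The generators and the group\<close>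

text \<open>The generators \<open>c\<close>, \<open>b\<close>, \<open>a\<close> are indexed by the digit that they leave alone, so that each
  argument is made once instead of three times.\<close>

primrec peg_swap :: "digit \<Rightarrow> digit \<Rightarrow> digit" where
  "peg_swap D0 x = (case x of D0 \<Rightarrow> D0 | D1 \<Rightarrow> D2 | D2 \<Rightarrow> D1)"
| "peg_swap D1 x = (case x of D0 \<Rightarrow> D2 | D1 \<Rightarrow> D1 | D2 \<Rightarrow> D0)"
| "peg_swap D2 x = (case x of D0 \<Rightarrow> D1 | D1 \<Rightarrow> D0 | D2 \<Rightarrow> D2)"

primrec hanoi_move :: "digit \<Rightarrow> vertex \<Rightarrow> vertex" where
  "hanoi_move D0 = hanoi_c"
| "hanoi_move D1 = hanoi_b"
| "hanoi_move D2 = hanoi_a"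

lemma peg_swap_eq_iff: "peg_swap d x = x \<longleftrightarrow> x = d"
  by (cases d; cases x) simp_all

lemma UNIV_digit: "(UNIV :: digit set) = {D0, D1, D2}"
  using digit.exhaust by blast

lemma countable_digits: "countable (UNIV :: digit set)"
  unfolding UNIV_digit by (rule countable_finite) simp

lemma range_hanoi_move: "range hanoi_move = {hanoi_a, hanoi_b, hanoi_c}"
  unfolding UNIV_digit by auto

lemma hanoi_move_Cons:
  "hanoi_move d [] = []"
  "hanoi_move d (x # w) = peg_swap d x # (if x = d then hanoi_move d w else w)"
  by (cases d; cases x; simp)+

lemma hanoi_move_involution: "hanoi_move d \<circ> hanoi_move d = id"
proof
  have "peg_swap d (peg_swap d x) = x" "peg_swap d x = d \<longleftrightarrow> x = d" for x
    by (cases d; cases x; simp)+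
  then show "(hanoi_move d \<circ> hanoi_move d) w = id w" for w
    by (induction w) (simp_all add: hanoi_move_Cons)
qed

lemma hanoi_move_nth:
  "k < length w \<Longrightarrow> hanoi_move d w ! k = (if \<forall>j<k. w ! j = d then peg_swap d (w ! k) else w ! k)"
proof (induction w arbitrary: k)
  case (Cons x w)
  then show ?case
    by (cases k) (auto simp: hanoi_move_Cons peg_swap_eq_iff[THEN iffD2] less_Suc_eq_0_disj)
qed simp

lemma carrier_hanoi_group: "carrier hanoi_group = generate tree_aut_group (range hanoi_move)"
  unfolding hanoi_group_def carrier_subgroup_generated range_hanoi_move
  using hanoi_generators_in_carrier by (simp add: Int_absorb1)

lemma group_hanoi: "group hanoi_group"
  unfolding hanoi_group_def by (rule group.group_subgroup_generated[OF tree_aut_group_is_group])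

lemma hanoi_group_subset_tree_auts: "carrier hanoi_group \<subseteq> tree_auts"
  using group.carrier_subgroup_generated_subset[OF tree_aut_group_is_group]
  by (simp add: hanoi_group_def tree_aut_group_def)

lemma tree_aut_group_mult:
  assumes "g \<in> tree_auts" "h \<in> tree_auts"
  shows "g \<otimes>\<^bsub>tree_aut_group\<^esub> h = g \<circ> h"
  using assms by (auto simp: tree_aut_group_def BijGroup_def tree_auts_def Bij_def compose_def)

lemma hanoi_group_mult:
  assumes "g \<in> carrier hanoi_group" "h \<in> carrier hanoi_group"
  shows "g \<otimes>\<^bsub>hanoi_group\<^esub> h = g \<circ> h"
proof -
  have "g \<in> tree_auts" "h \<in> tree_auts"
    using assms hanoi_group_subset_tree_auts by blast+
  then show ?thesis by (simp add: hanoi_group_def tree_aut_group_mult)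
qed

lemma hanoi_group_one: "\<one>\<^bsub>hanoi_group\<^esub> = id"
  by (auto simp: hanoi_group_def tree_aut_group_def BijGroup_def)

lemma id_in_hanoi: "id \<in> carrier hanoi_group"
  using group.is_monoid[OF group_hanoi] monoid.one_closed hanoi_group_one by metis

lemma hanoi_move_in_hanoi: "hanoi_move d \<in> carrier hanoi_group"
  unfolding carrier_hanoi_group by (rule generate.incl) simp

lemma comp_in_hanoi:
  "g \<in> carrier hanoi_group \<Longrightarrow> h \<in> carrier hanoi_group \<Longrightarrow> g \<circ> h \<in> carrier hanoi_group"
  using group.is_monoid[OF group_hanoi] hanoi_group_mult monoid.m_closed by metis

lemma inv_hanoi_eqI:
  assumes "g \<in> carrier hanoi_group" "h \<in> carrier hanoi_group" "g \<circ> h = id"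
  shows "inv\<^bsub>hanoi_group\<^esub> h = g"
  using group.inv_equality[OF group_hanoi] assms by (simp add: hanoi_group_mult hanoi_group_one)

lemma inv_hanoi_move: "inv\<^bsub>hanoi_group\<^esub> (hanoi_move d) = hanoi_move d"
  by (simp add: inv_hanoi_eqI hanoi_move_in_hanoi hanoi_move_involution)

text \<open>As the generators are involutions, every element of the group is a product of generators, without
  inverses. The proof shows that multiplication from the left by any element of the group preserves
  \<open>P\<close>: unlike \<open>P\<close> itself, this property passes to products.\<close>

lemma hanoi_group_induct [consumes 1, case_names id move]:
  assumes g: "g \<in> carrier hanoi_group"
    and id: "P id"
    and move: "\<And>d g. g \<in> carrier hanoi_group \<Longrightarrow> P g \<Longrightarrow> P (hanoi_move d \<circ> g)"
  shows "P g"
proof -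
  have "\<forall>h\<in>carrier hanoi_group. P h \<longrightarrow> P (g \<circ> h)"
    using g[unfolded carrier_hanoi_group]
  proof induction
    case one
    then show ?case using hanoi_group_one by (simp add: hanoi_group_def)
  next
    case (incl s)
    then show ?case using move by blast
  next
    case (inv s)
    then obtain d where "s = hanoi_move d" by auto
    then have "inv\<^bsub>tree_aut_group\<^esub> s = hanoi_move d"
      using inv_hanoi_move[of d] hanoi_move_in_hanoi[of d]
        group.inv_subgroup_generated[OF tree_aut_group_is_group]
      by (simp add: hanoi_group_def)
    then show ?case using move by metis
  next
    case (eng g1 g2)
    then have in_hanoi: "g1 \<in> carrier hanoi_group" "g2 \<in> carrier hanoi_group"
      by (simp_all add: carrier_hanoi_group)
    then have "g1 \<otimes>\<^bsub>tree_aut_group\<^esub> g2 = g1 \<circ> g2"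
      using hanoi_group_mult by (simp add: hanoi_group_def)
    moreover have "P (g1 \<circ> (g2 \<circ> h))" if "h \<in> carrier hanoi_group" "P h" for h
      using eng.IH comp_in_hanoi[OF in_hanoi(2)] that by blast
    ultimately show ?case by (simp only: comp_assoc) blast
  qed
  then show ?thesis using id id_in_hanoi by fastforce
qed

lemma countable_hanoi_group: "countable (carrier hanoi_group)"
proof (rule countable_subset)
  show "carrier hanoi_group \<subseteq> range (\<lambda>ds. foldr (\<lambda>d g. hanoi_move d \<circ> g) ds id)"
  proof
    show "g \<in> range (\<lambda>ds. foldr (\<lambda>d g. hanoi_move d \<circ> g) ds id)"
      if "g \<in> carrier hanoi_group" for g
      using that
    proof (induction rule: hanoi_group_induct)
      case id
      show ?case by (rule range_eqI[of _ _ "[]"]) simp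
    next
      case (move d g)
      then obtain ds where "g = foldr (\<lambda>d g. hanoi_move d \<circ> g) ds id" by blast
      then have "hanoi_move d \<circ> g = foldr (\<lambda>d g. hanoi_move d \<circ> g) (d # ds) id"
        by (simp only: foldr.simps comp_apply)
      then show ?case by (rule range_eqI)
    qed
  qed
  have "countable (UNIV :: digit list set)"
    using countable_lists[OF countable_digits] by simp
  then show "countable (range (\<lambda>ds. foldr (\<lambda>d g. hanoi_move d \<circ> g) ds id))"
    by (rule countable_image)
qed

section \<open>The action on the boundary\<close>

lemma tree_aut_prefix:
  assumes "h \<in> tree_auts"
  shows "length (h w) = length w \<and> h (take n w) = take n (h w)"
proof (induction w rule: rev_induct)
  case Nil
  then show ?case using assms by (simp add: tree_auts_def)
next
  case (snoc x w)
  have "child_of (h (w @ [x])) (h w)"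
    using assms by (auto simp: tree_auts_def child_of_def)
  then obtain y where "h (w @ [x]) = h w @ [y]"
    by (auto simp: child_of_def)
  with snoc show ?case
    by (cases "n \<le> length w") auto
qed

text \<open>The action on rays is the limit of the action on prefixes. This holds for automorphisms because
  they commute with taking prefixes.\<close>

lemma boundary_act_prefix:
  assumes "h \<in> tree_auts"
  shows "map (boundary_act h \<xi>) [0..<n] = h (map \<xi> [0..<n])"
proof (rule nth_equalityI)
  show "length (map (boundary_act h \<xi>) [0..<n]) = length (h (map \<xi> [0..<n]))"
    using tree_aut_prefix[OF assms] by simp
  fix k assume "k < length (map (boundary_act h \<xi>) [0..<n])"
  then have k: "k < n" by simp
  then have "map \<xi> [0..<Suc k] = take (Suc k) (map \<xi> [0..<n])"
    by (simp add: take_map del: upt_Suc)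
  then have "h (map \<xi> [0..<Suc k]) = take (Suc k) (h (map \<xi> [0..<n]))"
    using tree_aut_prefix[OF assms] by simp
  then show "map (boundary_act h \<xi>) [0..<n] ! k = h (map \<xi> [0..<n]) ! k"
    using k by (simp add: boundary_act_def)
qed

lemma boundary_act_comp:
  assumes "h \<in> tree_auts"
  shows "boundary_act (g \<circ> h) \<xi> = boundary_act g (boundary_act h \<xi>)"
  unfolding boundary_act_def[of g] boundary_act_prefix[OF assms]
  by (simp add: boundary_act_def)

lemma boundary_act_id [simp]: "boundary_act id \<xi> = \<xi>"
  by (simp add: boundary_act_def fun_eq_iff nth_append)

lemma boundary_act_comp_hanoi:
  assumes "h \<in> carrier hanoi_group"
  shows "boundary_act (g \<circ> h) \<xi> = boundary_act g (boundary_act h \<xi>)"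
  using assms hanoi_group_subset_tree_auts by (blast intro: boundary_act_comp)

interpretation hanoi: group hanoi_group
  by (rule group_hanoi)

interpretation boundary: group_action hanoi_group UNIV boundary_act
proof -
  have inverse: "boundary_act g (boundary_act h \<xi>) = \<xi>"
    if "g \<in> carrier hanoi_group" "h \<in> carrier hanoi_group" "g \<otimes>\<^bsub>hanoi_group\<^esub> h = \<one>\<^bsub>hanoi_group\<^esub>"
    for g h \<xi>
    using that by (metis boundary_act_comp_hanoi boundary_act_id hanoi_group_mult hanoi_group_one)
  have bij: "boundary_act g \<in> Bij UNIV" if "g \<in> carrier hanoi_group" for g
  proof -
    have "bij (boundary_act g)"
      by (rule o_bij[of "boundary_act (inv\<^bsub>hanoi_group\<^esub> g)"])
        (simp_all add: fun_eq_iff inverse that)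
    then show ?thesis by (simp add: Bij_def)
  qed
  have "boundary_act \<in> hom hanoi_group (BijGroup UNIV)"
  proof (rule homI)
    show "boundary_act g \<in> carrier (BijGroup UNIV)" if "g \<in> carrier hanoi_group" for g
      using bij[OF that] by (simp add: BijGroup_def)
    show "boundary_act (g \<otimes>\<^bsub>hanoi_group\<^esub> h) =
        boundary_act g \<otimes>\<^bsub>BijGroup UNIV\<^esub> boundary_act h"
      if "g \<in> carrier hanoi_group" "h \<in> carrier hanoi_group" for g h
      using that bij
      by (simp add: BijGroup_def hanoi_group_mult boundary_act_comp_hanoi fun_eq_iff compose_def)
  qed
  then show "group_action hanoi_group UNIV boundary_act"
    by (simp add: group_action_def group_hom_def group_hom_axioms_def group_hanoi group_BijGroup)
qed

text \<open>This formula carries all that is used about the individual generators. It also describes the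
  case that \<open>\<xi>\<close> has the digit \<open>d\<close> at position \<open>k\<close>, since \<open>peg_swap d\<close> fixes \<open>d\<close>.\<close>

lemma boundary_act_move:
  "boundary_act (hanoi_move d) \<xi> k = (if \<forall>j<k. \<xi> j = d then peg_swap d (\<xi> k) else \<xi> k)"
proof -
  have "map \<xi> [0..<Suc k] ! j = \<xi> j" if "j \<le> k" for j
    using that by (subst nth_map_upt) auto
  then show ?thesis
    by (simp add: boundary_act_def hanoi_move_nth del: upt_Suc cong: if_cong)
qed

lemma boundary_act_move_fixes_iff:
  "boundary_act (hanoi_move d) \<xi> = \<xi> \<longleftrightarrow> \<xi> = (\<lambda>_. d)"
proof
  assume fixed: "boundary_act (hanoi_move d) \<xi> = \<xi>"
  have "\<xi> k = d" for k
  proof (induction k rule: less_induct)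
    case (less k)
    then show ?case
      using fun_cong[OF fixed, of k] by (simp add: boundary_act_move peg_swap_eq_iff)
  qed
  then show "\<xi> = (\<lambda>_. d)" by blast
qed (simp add: boundary_act_move fun_eq_iff peg_swap_eq_iff)

lemma orbit_of_constant_eventually_constant:
  assumes "\<eta> \<in> hanoi_orbit (\<lambda>_. i)"
  shows "\<exists>n. \<forall>k\<ge>n. \<eta> k = i"
proof -
  obtain g where g: "g \<in> carrier hanoi_group" and \<eta>: "\<eta> = boundary_act g (\<lambda>_. i)"
    using assms by (auto simp: orbit_def)
  have "\<exists>n. \<forall>k\<ge>n. boundary_act g (\<lambda>_. i) k = i"
    using g
  proof (induction rule: hanoi_group_induct)
    case id
    show ?case unfolding boundary_act_id by blast
  next
    case (move d g)
    let ?\<xi> = "boundary_act g (\<lambda>_. i)"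
    obtain n where n: "\<forall>k\<ge>n. ?\<xi> k = i" using move.IH by blast
    have "boundary_act (hanoi_move d) ?\<xi> k = i" if k: "k > n" for k
      \<comment> \<open>The digit at position \<open>n\<close> is \<open>i\<close>, so a later digit can be swapped only if \<open>i = d\<close>;
        but then it is itself \<open>d\<close>, which the swap fixes.\<close>
      using n k peg_swap_eq_iff[of d d] by (auto simp: boundary_act_move)
    then show ?case
      unfolding boundary_act_comp_hanoi[OF move.hyps] by (metis Suc_le_eq)
  qed
  then show ?thesis by (simp add: \<eta>)
qed

lemma disjoint_constant_orbits: "disjoint_family (\<lambda>i. hanoi_orbit (\<lambda>_. i))"
proof (unfold disjoint_family_on_def, intro ballI impI)
  fix i j :: digit assume "i \<noteq> j"
  have False if \<eta>: "\<eta> \<in> hanoi_orbit (\<lambda>_. i)" "\<eta> \<in> hanoi_orbit (\<lambda>_. j)" for \<eta>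
  proof -
    obtain m n where "\<forall>k\<ge>m. \<eta> k = i" "\<forall>k\<ge>n. \<eta> k = j"
      using \<eta>[THEN orbit_of_constant_eventually_constant] by blast
    then have "\<eta> (max m n) = i" "\<eta> (max m n) = j"
      by (meson max.cobounded1 max.cobounded2)+
    with \<open>i \<noteq> j\<close> show False by simp
  qed
  then show "hanoi_orbit (\<lambda>_. i) \<inter> hanoi_orbit (\<lambda>_. j) = {}" by blast
qed

section \<open>Singular points\<close>

definition agree :: "nat \<Rightarrow> boundary \<Rightarrow> boundary \<Rightarrow> bool" where
  "agree n \<xi> \<eta> \<longleftrightarrow> (\<forall>k<n. \<eta> k = \<xi> k)"

lemma openin_boundary_iff:
  "openin boundary_topology S \<longleftrightarrow> (\<forall>\<xi>\<in>S. \<exists>n. \<forall>\<eta>. agree n \<xi> \<eta> \<longrightarrow> \<eta> \<in> S)"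
proof
  assume S: "openin boundary_topology S"
  show "\<forall>\<xi>\<in>S. \<exists>n. \<forall>\<eta>. agree n \<xi> \<eta> \<longrightarrow> \<eta> \<in> S"
  proof
    fix \<xi> assume "\<xi> \<in> S"
    then obtain U where U: "finite {i. U i \<noteq> UNIV}" "\<xi> \<in> Pi\<^sub>E UNIV U" "Pi\<^sub>E UNIV U \<subseteq> S"
      using S by (auto simp: boundary_topology_def openin_product_topology_alt)
    obtain n where n: "\<forall>i\<in>{i. U i \<noteq> UNIV}. i < n"
      using U(1) by (auto simp: finite_nat_set_iff_bounded)
    have "\<eta> \<in> Pi\<^sub>E UNIV U" if "agree n \<xi> \<eta>" for \<eta>
      using U(2) n that by (fastforce simp: agree_def PiE_iff)
    then show "\<exists>n. \<forall>\<eta>. agree n \<xi> \<eta> \<longrightarrow> \<eta> \<in> S" using U(3) by blast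
  qed
next
  assume S: "\<forall>\<xi>\<in>S. \<exists>n. \<forall>\<eta>. agree n \<xi> \<eta> \<longrightarrow> \<eta> \<in> S"
  show "openin boundary_topology S"
    unfolding boundary_topology_def openin_product_topology_alt
  proof
    fix \<xi> assume "\<xi> \<in> S"
    then obtain n where n: "\<forall>\<eta>. agree n \<xi> \<eta> \<longrightarrow> \<eta> \<in> S" using S by blast
    let ?U = "\<lambda>i. if i < n then {\<xi> i} else UNIV"
    have "finite {i. ?U i \<noteq> UNIV}"
      by (rule finite_subset[of _ "{..<n}"]) auto
    moreover have "Pi\<^sub>E UNIV ?U \<subseteq> S"
      using n by (auto simp: agree_def PiE_iff split: if_splits)
    ultimately show "\<exists>U. finite {i \<in> UNIV. U i \<noteq> topspace (discrete_topology UNIV)} \<and>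
        (\<forall>i\<in>UNIV. openin (discrete_topology UNIV) (U i)) \<and> \<xi> \<in> Pi\<^sub>E UNIV U \<and> Pi\<^sub>E UNIV U \<subseteq> S"
      by (intro exI[of _ ?U]) auto
  qed
qed

text \<open>A neighbourhood of a subgroup prescribes the membership of finitely many elements only, so
  continuity can be tested on one element of \<open>G\<close> at a time.\<close>

lemma topcontinuous_at_subgroup_iff:
  assumes K: "\<And>\<eta>. subgroup (K \<eta>) G"
  shows "topcontinuous_at boundary_topology (subgroup_topology G) K \<xi> \<longleftrightarrow>
    (\<forall>g\<in>carrier G. \<exists>n. \<forall>\<eta>. agree n \<xi> \<eta> \<longrightarrow> (g \<in> K \<eta> \<longleftrightarrow> g \<in> K \<xi>))"
    (is "?cont \<longleftrightarrow> ?local")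
proof
  let ?ind = "\<lambda>H. \<lambda>g\<in>carrier G. g \<in> H"
  let ?B = "product_topology (\<lambda>_. discrete_topology (UNIV :: bool set)) (carrier G)"
  assume cont: ?cont
  show ?local
  proof
    fix g assume g: "g \<in> carrier G"
    let ?U = "{f \<in> topspace ?B. f g \<in> {g \<in> K \<xi>}}"
    have U: "openin ?B ?U"
      by (rule openin_continuous_map_preimage
          [OF continuous_map_product_projection[OF g, of "\<lambda>_. discrete_topology UNIV"]]) simp
    let ?V = "?ind -` ?U \<inter> {H. subgroup H G}"
    have "openin (subgroup_topology G) ?V"
      unfolding subgroup_topology_def openin_pullback_topology using U by blast
    moreover have V: "K \<eta> \<in> ?V \<longleftrightarrow> (g \<in> K \<eta> \<longleftrightarrow> g \<in> K \<xi>)" for \<eta>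
      using K g by auto
    ultimately obtain W where "openin boundary_topology W" "\<xi> \<in> W" "\<forall>\<eta>\<in>W. K \<eta> \<in> ?V"
      using cont unfolding topcontinuous_at_def by blast
    then show "\<exists>n. \<forall>\<eta>. agree n \<xi> \<eta> \<longrightarrow> (g \<in> K \<eta> \<longleftrightarrow> g \<in> K \<xi>)"
      unfolding openin_boundary_iff V by blast
  qed
next
  let ?ind = "\<lambda>H. \<lambda>g\<in>carrier G. g \<in> H"
  let ?B = "product_topology (\<lambda>_. discrete_topology (UNIV :: bool set)) (carrier G)"
  assume local: ?local
  have "\<xi> \<in> topspace boundary_topology"
    by (simp add: boundary_topology_def)
  moreover have "K \<in> topspace boundary_topology \<rightarrow> topspace (subgroup_topology G)"
    using K by (auto simp: subgroup_topology_def topspace_pullback_topology)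
  moreover have "\<exists>W. openin boundary_topology W \<and> \<xi> \<in> W \<and> (\<forall>\<eta>\<in>W. K \<eta> \<in> V)"
    if V: "openin (subgroup_topology G) V" "K \<xi> \<in> V" for V
  proof -
    obtain U where U: "openin ?B U" "V = ?ind -` U \<inter> {H. subgroup H G}"
      using V(1) by (auto simp: subgroup_topology_def openin_pullback_topology)
    then obtain X where X: "finite {g \<in> carrier G. X g \<noteq> UNIV}" "?ind (K \<xi>) \<in> Pi\<^sub>E (carrier G) X"
        "Pi\<^sub>E (carrier G) X \<subseteq> U"
      using V(2) by (auto simp: openin_product_topology_alt)
    obtain n where n: "\<And>g \<eta>. g \<in> carrier G \<Longrightarrow> agree (n g) \<xi> \<eta> \<Longrightarrow> g \<in> K \<eta> \<longleftrightarrow> g \<in> K \<xi>"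
      using local by metis
    define N where "N = Max (insert 0 (n ` {g \<in> carrier G. X g \<noteq> UNIV}))"
    have le_N: "n g \<le> N" if "g \<in> carrier G" "X g \<noteq> UNIV" for g
      using X(1) that by (auto simp: N_def intro: Max_ge)
    have "K \<eta> \<in> V" if \<eta>: "agree N \<xi> \<eta>" for \<eta>
    proof -
      have "(g \<in> K \<eta>) \<in> X g" if g: "g \<in> carrier G" for g
      proof (cases "X g = UNIV")
        case False
        then have "agree (n g) \<xi> \<eta>"
          using le_N[OF g] \<eta> by (auto simp: agree_def)
        then show ?thesis using n[OF g] X(2) g by (auto simp: PiE_iff)
      qed simp
      then have "?ind (K \<eta>) \<in> Pi\<^sub>E (carrier G) X" by auto
      then show ?thesis using U(2) X(3) K by blast
    qed
    moreover have "openin boundary_topology {\<eta>. agree N \<xi> \<eta>}"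
      unfolding openin_boundary_iff by (auto simp: agree_def intro!: exI[of _ N])
    moreover have "\<xi> \<in> {\<eta>. agree N \<xi> \<eta>}" by (simp add: agree_def)
    ultimately show ?thesis by blast
  qed
  ultimately show ?cont unfolding topcontinuous_at_def by blast
qed

lemma singular_points_iff:
  "\<xi> \<in> singular_points \<longleftrightarrow>
    (\<exists>g\<in>carrier hanoi_group. \<forall>n. \<exists>\<eta>. agree n \<xi> \<eta> \<and>
       (boundary_act g \<eta> = \<eta> \<longleftrightarrow> boundary_act g \<xi> \<noteq> \<xi>))"
proof -
  have "subgroup (stabilizer hanoi_group boundary_act \<eta>) hanoi_group" for \<eta>
    by (rule boundary.stabilizer_subgroup) simp
  from topcontinuous_at_subgroup_iff[of "stabilizer hanoi_group boundary_act", OF this]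
  show ?thesis
    by (auto simp: singular_points_def stabilizer_def)
qed

text \<open>The germ of \<open>g\<close> at \<open>\<xi>\<close> rewrites the prefix of length \<open>n\<close> and keeps the tail.\<close>

definition acts_on_prefix :: "(vertex \<Rightarrow> vertex) \<Rightarrow> boundary \<Rightarrow> nat \<Rightarrow> bool" where
  "acts_on_prefix g \<xi> n \<longleftrightarrow>
     (\<forall>\<eta> k. agree n \<xi> \<eta> \<longrightarrow>
        boundary_act g \<eta> k = (if k < n then boundary_act g \<xi> k else \<eta> k))"

lemma acts_on_prefix_mono:
  assumes g: "acts_on_prefix g \<xi> m" and mn: "m \<le> n"
  shows "acts_on_prefix g \<xi> n"
  unfolding acts_on_prefix_def
proof (intro allI impI)
  fix \<eta> k assume \<eta>: "agree n \<xi> \<eta>"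
  then have "agree m \<xi> \<eta>" using mn by (simp add: agree_def)
  moreover have "agree m \<xi> \<xi>" by (simp add: agree_def)
  ultimately have "boundary_act g \<eta> k = (if k < m then boundary_act g \<xi> k else \<eta> k)"
      "boundary_act g \<xi> k = (if k < m then boundary_act g \<xi> k else \<xi> k)"
    using g unfolding acts_on_prefix_def by blast+
  then show "boundary_act g \<eta> k = (if k < n then boundary_act g \<xi> k else \<eta> k)"
    using \<eta> mn by (auto simp: agree_def split: if_splits)
qed

text \<open>The first digit of \<open>\<xi>\<close> that differs from \<open>d\<close> stops the move: it never looks further. Any
  such digit bounds the prefix.\<close>

lemma acts_on_prefix_move:
  assumes "\<xi> \<noteq> (\<lambda>_. d)"
  shows "\<exists>n. acts_on_prefix (hanoi_move d) \<xi> n"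
proof -
  obtain m where m: "\<xi> m \<noteq> d" using assms by blast
  have "boundary_act (hanoi_move d) \<eta> k = (if k < Suc m then boundary_act (hanoi_move d) \<xi> k else \<eta> k)"
    if \<eta>: "agree (Suc m) \<xi> \<eta>" for \<eta> k
  proof (cases "k < Suc m")
    case True
    then have "(\<forall>j<k. \<eta> j = d) \<longleftrightarrow> (\<forall>j<k. \<xi> j = d)" "\<eta> k = \<xi> k"
      using \<eta> by (auto simp: agree_def)
    then show ?thesis using True by (simp only: boundary_act_move if_True)
  next
    case False
    then have "\<eta> m \<noteq> d" "m < k" using m \<eta> by (auto simp: agree_def)
    then show ?thesis using False by (auto simp: boundary_act_move)
  qed
  then show ?thesis unfolding acts_on_prefix_def by blast
qed

lemma acts_on_prefix_comp:
  assumes h: "h \<in> carrier hanoi_group" "acts_on_prefix h \<xi> n"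
    and g: "acts_on_prefix g (boundary_act h \<xi>) n"
  shows "acts_on_prefix (g \<circ> h) \<xi> n"
  unfolding acts_on_prefix_def
proof (intro allI impI)
  fix \<eta> k assume "agree n \<xi> \<eta>"
  then have h_\<eta>: "\<forall>k. boundary_act h \<eta> k = (if k < n then boundary_act h \<xi> k else \<eta> k)"
    using h(2) by (simp add: acts_on_prefix_def)
  then have "agree n (boundary_act h \<xi>) (boundary_act h \<eta>)" by (simp add: agree_def)
  then have "boundary_act g (boundary_act h \<eta>) k =
      (if k < n then boundary_act g (boundary_act h \<xi>) k else boundary_act h \<eta> k)"
    using g by (simp add: acts_on_prefix_def)
  then show "boundary_act (g \<circ> h) \<eta> k = (if k < n then boundary_act (g \<circ> h) \<xi> k else \<eta> k)"
    using h_\<eta> by (simp add: boundary_act_comp_hanoi[OF h(1)])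
qed

text \<open>A letter of \<open>g\<close> fails to act on a prefix only at its fixed ray, which no letter meets on the way
  from a ray \<open>\<xi>\<close> outside the orbits of these fixed rays.\<close>

lemma acts_on_prefix_off_constant_orbits:
  assumes g: "g \<in> carrier hanoi_group" and \<xi>: "\<And>i. \<xi> \<notin> hanoi_orbit (\<lambda>_. i)"
  shows "\<exists>n. acts_on_prefix g \<xi> n"
  using g
proof (induction rule: hanoi_group_induct)
  case id
  show ?case unfolding acts_on_prefix_def boundary_act_id by (intro exI[of _ 0]) simp
next
  case (move d g)
  have "boundary_act g \<xi> \<noteq> (\<lambda>_. d)"
  proof
    assume "boundary_act g \<xi> = (\<lambda>_. d)"
    then have "(\<lambda>_. d) \<in> hanoi_orbit \<xi>" using move.hyps by (force simp: orbit_def)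
    then show False using boundary.orbit_sym \<xi> by blast
  qed
  then obtain m n where "acts_on_prefix g \<xi> m" "acts_on_prefix (hanoi_move d) (boundary_act g \<xi>) n"
    using move.IH acts_on_prefix_move by blast
  then show ?case
    using acts_on_prefix_comp[OF move.hyps] acts_on_prefix_mono max.cobounded1 max.cobounded2
    by metis
qed

lemma singular_only_in_constant_orbits:
  assumes "\<xi> \<in> singular_points"
  shows "\<exists>i. \<xi> \<in> hanoi_orbit (\<lambda>_. i)"
proof (rule ccontr)
  assume "\<nexists>i. \<xi> \<in> hanoi_orbit (\<lambda>_. i)"
  then have prefix: "\<exists>n. acts_on_prefix g \<xi> n" if "g \<in> carrier hanoi_group" for g
    using acts_on_prefix_off_constant_orbits that by blast
  obtain g where g: "g \<in> carrier hanoi_group"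
    and sing: "\<And>n. \<exists>\<eta>. agree n \<xi> \<eta> \<and> (boundary_act g \<eta> = \<eta> \<longleftrightarrow> boundary_act g \<xi> \<noteq> \<xi>)"
    using assms singular_points_iff by blast
  obtain n where n: "acts_on_prefix g \<xi> n" using prefix[OF g] by blast
  obtain \<eta> where \<eta>: "agree n \<xi> \<eta>" "boundary_act g \<eta> = \<eta> \<longleftrightarrow> boundary_act g \<xi> \<noteq> \<xi>"
    using sing by blast
  have "agree n \<xi> \<xi>" by (simp add: agree_def)
  with n \<eta>(1) have "boundary_act g \<eta> k = (if k < n then boundary_act g \<xi> k else \<eta> k)"
      "boundary_act g \<xi> k = (if k < n then boundary_act g \<xi> k else \<xi> k)" for k
    unfolding acts_on_prefix_def by blast+
  moreover have "\<eta> k = \<xi> k" if "k < n" for k using \<eta>(1) that by (simp add: agree_def)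
  ultimately have "boundary_act g \<eta> = \<eta> \<longleftrightarrow> boundary_act g \<xi> = \<xi>"
    unfolding fun_eq_iff by metis
  then show False using \<eta>(2) by blast
qed

text \<open>A conjugate of a generator has \<open>\<xi>\<close> as its only fixed ray, and \<open>\<xi>\<close> is not isolated in the
  boundary.\<close>

lemma constant_orbits_singular:
  assumes "\<xi> \<in> hanoi_orbit (\<lambda>_. i)"
  shows "\<xi> \<in> singular_points"
proof -
  obtain g where g: "g \<in> carrier hanoi_group" and \<xi>: "\<xi> = boundary_act g (\<lambda>_. i)"
    using assms by (auto simp: orbit_def)
  let ?g' = "inv\<^bsub>hanoi_group\<^esub> g"
  let ?h = "g \<circ> (hanoi_move i \<circ> ?g')"
  have g': "?g' \<in> carrier hanoi_group" using g by simp
  then have h: "?h \<in> carrier hanoi_group"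
    using g by (intro comp_in_hanoi hanoi_move_in_hanoi)
  have h_fixes: "boundary_act ?h \<eta> = \<eta> \<longleftrightarrow> \<eta> = \<xi>" for \<eta>
  proof -
    have swap: "boundary_act g \<alpha> = \<beta> \<longleftrightarrow> \<alpha> = boundary_act ?g' \<beta>" for \<alpha> \<beta>
      using boundary.orbit_sym_aux[OF g] boundary.orbit_sym_aux[OF g'] g
      by (metis UNIV_I hanoi.inv_inv)
    have "boundary_act ?h \<eta> = boundary_act g (boundary_act (hanoi_move i) (boundary_act ?g' \<eta>))"
      using g' by (simp add: boundary_act_comp_hanoi comp_in_hanoi hanoi_move_in_hanoi)
    then have "boundary_act ?h \<eta> = \<eta> \<longleftrightarrow> boundary_act ?g' \<eta> = (\<lambda>_. i)"
      by (simp add: swap boundary_act_move_fixes_iff)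
    then show ?thesis using swap \<xi> by metis
  qed
  have "\<exists>\<eta>. agree n \<xi> \<eta> \<and> (boundary_act ?h \<eta> = \<eta> \<longleftrightarrow> boundary_act ?h \<xi> \<noteq> \<xi>)" for n
  proof -
    obtain x where "x \<noteq> \<xi> n" by (metis digit.distinct(1))
    then have "agree n \<xi> (\<xi>(n := x))" "\<xi>(n := x) \<noteq> \<xi>"
      by (auto simp: agree_def fun_eq_iff)
    then show ?thesis unfolding h_fixes by blast
  qed
  then show ?thesis using h singular_points_iff by blast
qed

section \<open>Balls in marked labeled graphs\<close>

text \<open>The isomorphism is kept explicit because the isomorphisms of different balls have to be compared
  and glued below.\<close>

definition graph_iso ::
    "('v \<Rightarrow> 'w) \<Rightarrow> ('v, 'l) marked_graph \<Rightarrow> ('w, 'l) marked_graph \<Rightarrow> bool" where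
  "graph_iso f G G' \<longleftrightarrow> bij_betw f (verts G) (verts G') \<and> f (mark G) = mark G' \<and>
     (\<forall>u\<in>verts G. \<forall>v\<in>verts G. \<forall>l. (u, l, v) \<in> edges G \<longleftrightarrow> (f u, l, f v) \<in> edges G')"

lemma graph_isomorphic_iff: "graph_isomorphic G G' \<longleftrightarrow> (\<exists>f. graph_iso f G G')"
  by (simp add: graph_isomorphic_def graph_iso_def)

lemma graph_iso_inverse:
  assumes f: "graph_iso f G G'" and m: "mark G \<in> verts G"
  shows "graph_iso (inv_into (verts G) f) G' G"
proof -
  have b: "bij_betw f (verts G) (verts G')" using f by (simp add: graph_iso_def)
  have "inv_into (verts G) f w \<in> verts G" "f (inv_into (verts G) f w) = w" if "w \<in> verts G'" for w
    using b that by (auto simp: bij_betw_def inv_into_into f_inv_into_f)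
  moreover have "inv_into (verts G) f (mark G') = mark G"
    using f m b by (metis bij_betw_inv_into_left graph_iso_def)
  ultimately show ?thesis
    using f bij_betw_inv_into[OF b] unfolding graph_iso_def by metis
qed

lemma graph_isomorphic_refl: "graph_isomorphic G G"
  unfolding graph_isomorphic_iff graph_iso_def by (rule exI[of _ id]) simp

lemma graph_isomorphic_sym:
  "graph_isomorphic G G' \<Longrightarrow> mark G \<in> verts G \<Longrightarrow> graph_isomorphic G' G"
  unfolding graph_isomorphic_iff using graph_iso_inverse by blast

lemma graph_isomorphic_trans:
  assumes "graph_isomorphic G G'" "graph_isomorphic G' G''"
  shows "graph_isomorphic G G''"
proof -
  obtain f g where "graph_iso f G G'" "graph_iso g G' G''"
    using assms unfolding graph_isomorphic_iff by blast
  then have "graph_iso (g \<circ> f) G G''"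
    unfolding graph_iso_def by (auto intro: bij_betw_trans dest: bij_betwE)
  then show ?thesis using graph_isomorphic_iff by blast
qed

lemma iso_class_eq_iff:
  assumes "is_marked_graph G" "is_marked_graph G'"
  shows "iso_class G = iso_class G' \<longleftrightarrow> graph_isomorphic G G'"
proof
  show "graph_isomorphic G G'" if "iso_class G = iso_class G'"
    using that assms graph_isomorphic_refl[of G'] by (auto simp: iso_class_def)
  have m: "mark G \<in> verts G" using assms by (simp add: is_marked_graph_def)
  show "iso_class G = iso_class G'" if "graph_isomorphic G G'"
    using graph_isomorphic_trans graph_isomorphic_sym[OF that m] that
    unfolding iso_class_def by blast
qed

lemma adjacent_in_verts:
  assumes "is_marked_graph G" "(u, v) \<in> adjacent G"
  shows "u \<in> verts G \<and> v \<in> verts G"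
  using assms by (auto simp: is_marked_graph_def adjacent_def)

lemma ball_verts_subset:
  assumes "is_marked_graph G"
  shows "ball_verts G r \<subseteq> verts G"
proof
  have "v \<in> verts G" if "(mark G, v) \<in> adjacent G ^^ k" for v k
    using that assms
    by (cases k) (auto simp: is_marked_graph_def dest: adjacent_in_verts[OF assms])
  then show "v \<in> verts G" if "v \<in> ball_verts G r" for v
    using that by (auto simp: ball_verts_def)
qed

lemma verts_in_ball:
  assumes "is_marked_graph G" "v \<in> verts G"
  shows "\<exists>k. (mark G, v) \<in> adjacent G ^^ k"
  using assms by (auto simp: is_marked_graph_def rtrancl_imp_relpow)

lemma graph_iso_ball_subset:
  assumes f: "graph_iso f G G'" and G: "is_marked_graph G"
  shows "f ` ball_verts G r \<subseteq> ball_verts G' r"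
proof -
  have "(mark G', f v) \<in> adjacent G' ^^ k" if "(mark G, v) \<in> adjacent G ^^ k" for v k
    using that
  proof (induction k arbitrary: v)
    case 0
    then show ?case using f by (auto simp: graph_iso_def)
  next
    case (Suc k)
    then obtain u where u: "(mark G, u) \<in> adjacent G ^^ k" "(u, v) \<in> adjacent G" by auto
    then have "(f u, f v) \<in> adjacent G'"
      using f adjacent_in_verts[OF G u(2)] by (auto simp: adjacent_def graph_iso_def)
    then show ?case using Suc.IH[OF u(1)] by auto
  qed
  then show ?thesis by (auto simp: ball_verts_def)
qed

lemma graph_isomorphic_ball:
  assumes iso: "graph_isomorphic G G'" and G: "is_marked_graph G" and G': "is_marked_graph G'"
  shows "graph_isomorphic (graph_ball G r) (graph_ball G' r)"
proof -
  obtain f where f: "graph_iso f G G'" using iso graph_isomorphic_iff by blast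
  let ?f' = "inv_into (verts G) f"
  have f': "graph_iso ?f' G' G"
    using graph_iso_inverse[OF f] G by (simp add: is_marked_graph_def)
  have b: "bij_betw f (verts G) (verts G')" using f by (simp add: graph_iso_def)
  have "ball_verts G' r \<subseteq> f ` ball_verts G r"
  proof
    fix w assume w: "w \<in> ball_verts G' r"
    then have "f (?f' w) = w"
      using b ball_verts_subset[OF G'] by (meson bij_betw_inv_into_right subsetD)
    then show "w \<in> f ` ball_verts G r"
      using graph_iso_ball_subset[OF f' G'] w by (metis image_eqI image_subset_iff)
  qed
  then have "f ` ball_verts G r = ball_verts G' r"
    using graph_iso_ball_subset[OF f G] by blast
  moreover have "inj_on f (ball_verts G r)"
    using b ball_verts_subset[OF G] by (meson bij_betw_def inj_on_subset)
  moreover have "(u, l, v) \<in> edges G \<longleftrightarrow> (f u, l, f v) \<in> edges G'"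
    if "u \<in> ball_verts G r" "v \<in> ball_verts G r" for u v l
    using f ball_verts_subset[OF G, of r] that by (auto simp: graph_iso_def subset_iff)
  ultimately have "graph_iso f (graph_ball G r) (graph_ball G' r)"
    using f by (auto simp: graph_iso_def graph_ball_def bij_betw_def)
  then show ?thesis using graph_isomorphic_iff by blast
qed

lemma mark_in_ball: "mark G \<in> ball_verts G r"
  unfolding ball_verts_def by (auto intro: exI[of _ 0])

lemma loop_at_mark_ball:
  assumes "graph_isomorphic (graph_ball G r) (graph_ball G' r)"
  shows "(mark G, l, mark G) \<in> edges G \<longleftrightarrow> (mark G', l, mark G') \<in> edges G'"
proof -
  obtain f where f: "graph_iso f (graph_ball G r) (graph_ball G' r)"
    using assms graph_isomorphic_iff by blast
  then have "f (mark G) = mark G'" by (simp add: graph_iso_def graph_ball_def)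
  moreover have "(mark G, l, mark G) \<in> edges (graph_ball G r) \<longleftrightarrow>
      (f (mark G), l, f (mark G)) \<in> edges (graph_ball G' r)"
    using f mark_in_ball[of G r] by (simp add: graph_iso_def graph_ball_def)
  ultimately show ?thesis
    using mark_in_ball[of G r] mark_in_ball[of G' r] by (simp add: graph_ball_def)
qed

text \<open>Folded in the sense of Stallings: an edge is determined by its label and either of its ends. Both
  directions are required, since adjacency traverses edges backwards as well.\<close>

definition folded :: "('v, 'l) marked_graph \<Rightarrow> bool" where
  "folded G \<longleftrightarrow>
     (\<forall>u l v v'. (u, l, v) \<in> edges G \<and> (u, l, v') \<in> edges G \<longrightarrow> v = v') \<and>
     (\<forall>u l v v'. (v, l, u) \<in> edges G \<and> (v', l, u) \<in> edges G \<longrightarrow> v = v')"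

lemma ball_iso_edge_iff:
  assumes f: "graph_iso f (graph_ball G r) (graph_ball S r)"
    and uv: "u \<in> ball_verts G r" "v \<in> ball_verts G r"
  shows "(u, l, v) \<in> edges G \<longleftrightarrow> (f u, l, f v) \<in> edges S"
proof -
  have "bij_betw f (ball_verts G r) (ball_verts S r)"
    using f by (simp add: graph_iso_def graph_ball_def)
  then have "f u \<in> ball_verts S r" "f v \<in> ball_verts S r"
    using uv bij_betwE by blast+
  then show ?thesis
    using f uv by (simp add: graph_iso_def graph_ball_def)
qed

text \<open>An isomorphism of balls is forced by the image of the mark: by folding, the image of a vertex
  determines the images of its neighbours, along any path from the mark.\<close>

lemma ball_isos_agree:
  assumes S: "folded S"
    and f: "graph_iso f (graph_ball G r) (graph_ball S r)"
    and f': "graph_iso f' (graph_ball G r') (graph_ball S r')"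
    and v: "(mark G, v) \<in> adjacent G ^^ k" "k \<le> r" "k \<le> r'"
  shows "f v = f' v"
  using v
proof (induction k arbitrary: v)
  case 0
  then show ?case using f f' by (auto simp: graph_iso_def graph_ball_def)
next
  case (Suc k)
  then obtain u where u: "(mark G, u) \<in> adjacent G ^^ k" "(u, v) \<in> adjacent G" by auto
  then have fu: "f u = f' u" using Suc by simp
  have "k \<le> r" "k \<le> r'" using Suc.prems by simp_all
  then have balls:
    "u \<in> ball_verts G r" "v \<in> ball_verts G r" "u \<in> ball_verts G r'" "v \<in> ball_verts G r'"
    using u(1) Suc.prems unfolding ball_verts_def by blast+
  have edge: "(f x, l, f y) \<in> edges S \<and> (f' x, l, f' y) \<in> edges S"
    if "(x, l, y) \<in> edges G" "x \<in> {u, v}" "y \<in> {u, v}" for x l y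
  proof -
    have "x \<in> ball_verts G r \<inter> ball_verts G r'" "y \<in> ball_verts G r \<inter> ball_verts G r'"
      using that(2,3) balls by blast+
    then show ?thesis
      using that(1) ball_iso_edge_iff[OF f] ball_iso_edge_iff[OF f'] by blast
  qed
  obtain l where "(u, l, v) \<in> edges G \<or> (v, l, u) \<in> edges G"
    using u(2) by (auto simp: adjacent_def)
  then show ?case
  proof
    assume "(u, l, v) \<in> edges G"
    from edge[OF this] show ?thesis using S unfolding folded_def fu by (metis insertCI)
  next
    assume "(v, l, u) \<in> edges G"
    from edge[OF this] show ?thesis using S unfolding folded_def fu by (metis insertCI)
  qed
qed

text \<open>Isomorphisms of balls need not fit together in general; here they are unique, hence glue to an
  isomorphism of the graphs.\<close>

lemma graph_isomorphic_if_balls_isomorphic: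
  assumes G: "is_marked_graph G" and S: "is_marked_graph S" "folded S"
    and balls: "\<And>r. graph_isomorphic (graph_ball G r) (graph_ball S r)"
  shows "graph_isomorphic G S"
proof -
  obtain h where h: "\<And>r. graph_iso (h r) (graph_ball G r) (graph_ball S r)"
    using balls unfolding graph_isomorphic_iff by metis
  \<comment> \<open>The distance from the mark: from radius \<open>d v\<close> on, all isomorphisms \<open>h r\<close> agree at \<open>v\<close>.\<close>
  define d where "d v = (LEAST k. (mark G, v) \<in> adjacent G ^^ k)" for v
  define f where "f v = h (d v) v" for v
  have d: "(mark G, v) \<in> adjacent G ^^ d v" if "v \<in> verts G" for v
    using verts_in_ball[OF G that] unfolding d_def by (rule LeastI_ex)
  have f: "f v = h r v" if "v \<in> verts G" "d v \<le> r" for v r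
    unfolding f_def using ball_isos_agree[OF S(2) h h d[OF that(1)] order.refl that(2)] .
  have in_ball: "v \<in> ball_verts G r" if "v \<in> verts G" "d v \<le> r" for v r
    using d that by (auto simp: ball_verts_def)
  have h_bij: "bij_betw (h r) (ball_verts G r) (ball_verts S r)" for r
    using h[of r] by (simp add: graph_iso_def graph_ball_def)
  have inj: "inj_on f (verts G)"
  proof (rule inj_onI)
    fix u v assume uv: "u \<in> verts G" "v \<in> verts G" "f u = f v"
    let ?r = "max (d u) (d v)"
    have "h ?r u = h ?r v" using uv f[of u ?r] f[of v ?r] by simp
    then show "u = v"
      using h_bij[of ?r] in_ball uv by (meson bij_betw_def inj_onD max.cobounded1 max.cobounded2)
  qed
  have "f ` verts G = verts S"
  proof
    show "f ` verts G \<subseteq> verts S"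
    proof (rule image_subsetI)
      fix v assume v: "v \<in> verts G"
      then have "h (d v) v \<in> ball_verts S (d v)"
        using h_bij in_ball bij_betwE by blast
      then show "f v \<in> verts S" using ball_verts_subset[OF S(1)] by (auto simp: f_def)
    qed
    show "verts S \<subseteq> f ` verts G"
    proof
      fix w assume "w \<in> verts S"
      then obtain r where "w \<in> ball_verts S r"
        using verts_in_ball[OF S(1)] unfolding ball_verts_def by blast
      then obtain v where v: "v \<in> ball_verts G r" "h r v = w"
        using h_bij[of r] by (metis bij_betw_def imageE)
      then have "v \<in> verts G" using ball_verts_subset[OF G] by blast
      moreover have "d v \<le> r"
        using v(1) unfolding d_def ball_verts_def by (auto intro: Least_le order.trans)
      ultimately have "f v = w" using f v(2) by simp
      with \<open>v \<in> verts G\<close> show "w \<in> f ` verts G" by blast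
    qed
  qed
  moreover have "f (mark G) = mark S"
    using f_def h by (simp add: graph_iso_def graph_ball_def)
  moreover have "(u, l, v) \<in> edges G \<longleftrightarrow> (f u, l, f v) \<in> edges S"
    if uv: "u \<in> verts G" "v \<in> verts G" for u v l
    using ball_iso_edge_iff[OF h, of u "max (d u) (d v)" v l] f[OF uv(1), of "max (d u) (d v)"]
      f[OF uv(2), of "max (d u) (d v)"] in_ball[OF uv(1), of "max (d u) (d v)"]
      in_ball[OF uv(2), of "max (d u) (d v)"] by simp
  ultimately have "graph_iso f G S" using inj by (simp add: graph_iso_def bij_betw_def)
  then show ?thesis using graph_isomorphic_iff by blast
qed

section \<open>Subbasic open sets of the space of graphs\<close>

text \<open>For marked graphs \<open>G\<close>, these sets form the subbase that defines the topology of the space of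
  graphs.\<close>

definition same_ball :: "('v, 'l) marked_graph \<Rightarrow> nat \<Rightarrow> ('v, 'l) marked_graph set set" where
  "same_ball G r =
     {iso_class G' |G'. is_marked_graph G' \<and> graph_isomorphic (graph_ball G r) (graph_ball G' r)}"

lemma openin_same_ball: "is_marked_graph G \<Longrightarrow> openin graph_space (same_ball G r)"
  unfolding graph_space_def by (rule topology_generated_by_Basis) (auto simp: same_ball_def)

lemma topspace_graph_space: "topspace graph_space = iso_class ` {G. is_marked_graph G}"
  using graph_isomorphic_refl unfolding graph_space_def by auto

text \<open>Membership does not depend on the representative of the isomorphism class.\<close>

lemma iso_class_in_same_ball_iff:
  assumes "is_marked_graph H"
  shows "iso_class H \<in> same_ball G r \<longleftrightarrow> graph_isomorphic (graph_ball G r) (graph_ball H r)"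
proof
  assume "iso_class H \<in> same_ball G r"
  then obtain G' where G': "is_marked_graph G'" "iso_class H = iso_class G'"
      "graph_isomorphic (graph_ball G r) (graph_ball G' r)"
    unfolding same_ball_def by blast
  then have "graph_isomorphic G' H"
    using assms iso_class_eq_iff by metis
  then show "graph_isomorphic (graph_ball G r) (graph_ball H r)"
    using G' assms graph_isomorphic_ball graph_isomorphic_trans by blast
next
  assume "graph_isomorphic (graph_ball G r) (graph_ball H r)"
  then show "iso_class H \<in> same_ball G r"
    using assms unfolding same_ball_def by blast
qed

section \<open>Schreier graphs\<close>

lemma label_map_in_hanoi: "label_map l \<in> carrier hanoi_group"
proof -
  have "state_map s \<in> carrier hanoi_group" for s
    using hanoi_move_in_hanoi[of D0] hanoi_move_in_hanoi[of D1] hanoi_move_in_hanoi[of D2]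
      id_in_hanoi by (cases s) (simp_all add: id_def)
  then show ?thesis by (cases l) simp_all
qed

primrec move_state :: "digit \<Rightarrow> state" where
  "move_state D0 = Sc"
| "move_state D1 = Sb"
| "move_state D2 = Sa"

lemma state_map_move_state: "state_map (move_state d) = hanoi_move d"
  by (cases d) simp_all

lemma is_marked_schreier_graph: "is_marked_graph (schreier_graph \<xi>)"
proof -
  let ?S = "schreier_graph \<xi>"
  have mark: "mark ?S \<in> verts ?S"
    by (simp add: schreier_graph_def boundary.orbit_refl)
  have closed: "boundary_act h \<eta> \<in> hanoi_orbit \<xi>"
    if "\<eta> \<in> hanoi_orbit \<xi>" "h \<in> carrier hanoi_group" for \<eta> h
    using that boundary.orbit_trans[of \<xi> \<eta>] by (auto simp: orbit_def)
  have "edges ?S \<subseteq> verts ?S \<times> UNIV \<times> verts ?S"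
    using closed label_map_in_hanoi by (auto simp: schreier_graph_def)
  moreover have "(\<xi>, boundary_act g \<xi>) \<in> (adjacent ?S)\<^sup>*" if "g \<in> carrier hanoi_group" for g
    using that
  proof (induction rule: hanoi_group_induct)
    case id
    show ?case unfolding boundary_act_id by (rule rtrancl_refl)
  next
    case (move d g)
    have "(boundary_act g \<xi>, Gen (move_state d), boundary_act (hanoi_move d) (boundary_act g \<xi>))
        \<in> edges ?S"
      using move.hyps by (auto simp: schreier_graph_def state_map_move_state orbit_def)
    then have "(boundary_act g \<xi>, boundary_act (hanoi_move d \<circ> g) \<xi>) \<in> adjacent ?S"
      unfolding adjacent_def boundary_act_comp_hanoi[OF move.hyps] by blast
    then show ?case using move.IH by (rule rtrancl_into_rtrancl[rotated])
  qed
  ultimately show ?thesis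
    using mark unfolding is_marked_graph_def by (auto simp: schreier_graph_def orbit_def)
qed

text \<open>Labels act by bijections.\<close>

lemma folded_schreier_graph: "folded (schreier_graph \<xi>)"
proof -
  have "\<eta> = \<eta>'" if "boundary_act (label_map l) \<eta> = boundary_act (label_map l) \<eta>'" for l \<eta> \<eta>'
    using boundary.inj_prop[OF label_map_in_hanoi] that by (simp add: inj_def)
  then show ?thesis unfolding folded_def schreier_graph_def by auto
qed

lemma schreier_graph_loop_iff:
  "(mark (schreier_graph \<xi>), Gen (move_state i), mark (schreier_graph \<xi>)) \<in> edges (schreier_graph \<xi>)
    \<longleftrightarrow> \<xi> = (\<lambda>_. i)"
proof -
  have "(\<xi>, Gen (move_state i), \<xi>) \<in> edges (schreier_graph \<xi>) \<longleftrightarrow> boundary_act (hanoi_move i) \<xi> = \<xi>"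
    by (auto simp: schreier_graph_def state_map_move_state boundary.orbit_refl)
  then show ?thesis by (simp add: boundary_act_move_fixes_iff schreier_graph_def)
qed

text \<open>The open set that isolates the point fixes the ball of radius \<open>0\<close> around the mark: among
  Schreier graphs, the loops in it already determine the constant ray.\<close>

lemma schreier_graph_constant_isolated:
  "openin (subtopology graph_space (graph_space closure_of range sch_map)) {sch_map (\<lambda>_. i)}"
proof -
  let ?C = "graph_space closure_of range sch_map"
  let ?S = "schreier_graph (\<lambda>_. i)"
  have S: "is_marked_graph ?S" by (rule is_marked_schreier_graph)
  have "sch_map (\<lambda>_. i) \<in> ?C"
  proof -
    have "range sch_map \<subseteq> topspace graph_space"
      by (auto simp: topspace_graph_space sch_map_def is_marked_schreier_graph)
    then have "range sch_map \<subseteq> ?C" by (rule closure_of_subset)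
    then show ?thesis by blast
  qed
  moreover have "sch_map (\<lambda>_. i) \<in> same_ball ?S 0"
    by (simp add: sch_map_def iso_class_in_same_ball_iff S graph_isomorphic_refl)
  moreover have "X = sch_map (\<lambda>_. i)" if X: "X \<in> same_ball ?S 0" "X \<in> ?C" for X
  proof -
    obtain G where G: "is_marked_graph G" and XG: "X = iso_class G"
      using X(1) by (auto simp: same_ball_def)
    have "graph_isomorphic (graph_ball ?S 0) (graph_ball G 0)"
      using X(1) G by (simp add: XG iso_class_in_same_ball_iff)
    then have loop: "(mark G, Gen (move_state i), mark G) \<in> edges G"
      using loop_at_mark_ball[of ?S 0 G "Gen (move_state i)"]
        schreier_graph_loop_iff[of "\<lambda>_. i" i] by simp
    have "graph_isomorphic (graph_ball G r) (graph_ball ?S r)" for r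
    proof -
      have "X \<in> same_ball G r"
        by (simp add: XG iso_class_in_same_ball_iff G graph_isomorphic_refl)
      then obtain \<xi> where "sch_map \<xi> \<in> same_ball G r"
        using X(2) openin_same_ball[OF G] unfolding in_closure_of by blast
      then have iso: "graph_isomorphic (graph_ball G r) (graph_ball (schreier_graph \<xi>) r)"
        by (simp add: sch_map_def iso_class_in_same_ball_iff is_marked_schreier_graph)
      then have "\<xi> = (\<lambda>_. i)"
        using loop_at_mark_ball[OF iso, of "Gen (move_state i)"] loop
          schreier_graph_loop_iff[of \<xi> i] by simp
      then show ?thesis using iso by simp
    qed
    then have "graph_isomorphic G ?S"
      using graph_isomorphic_if_balls_isomorphic[OF G S folded_schreier_graph] by blast
    then show ?thesis by (simp add: XG sch_map_def iso_class_eq_iff G S)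
  qed
  ultimately have "{sch_map (\<lambda>_. i)} = same_ball ?S 0 \<inter> ?C" by blast
  then show ?thesis
    unfolding openin_subtopology using openin_same_ball[OF S] by blast
qed

theorem corollary4p9:
  shows "countable singular_points \<and>
    singular_points = (\<Union>i. hanoi_orbit (\<lambda>_. i)) \<and>
    disjoint_family (\<lambda>i. hanoi_orbit (\<lambda>_. i)) \<and>
    (\<forall>i. openin (subtopology graph_space (graph_space closure_of range sch_map)) {sch_map (\<lambda>_. i)})"
proof (intro conjI allI)
  show singular: "singular_points = (\<Union>i. hanoi_orbit (\<lambda>_. i))"
    using singular_only_in_constant_orbits constant_orbits_singular by blast
  have "countable (hanoi_orbit \<xi>)" for \<xi>
    using countable_image[OF countable_hanoi_group, of "\<lambda>g. boundary_act g \<xi>"]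
    by (simp add: orbit_def Setcompr_eq_image)
  then show "countable singular_points"
    unfolding singular by (intro countable_UN countable_digits)
qed (fact disjoint_constant_orbits schreier_graph_constant_isolated)+

end
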